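(* Let $\mathcal{A}$ be a commutative Banach algebra, and let $\mathfrak{B}$ be an abstract Segal algebra with respect to $\mathcal{A}$ having an approximate identity $(e_\alpha)$. Suppose that $\varphi\in\mathrm{Hom}(\mathfrak{B})$ has a continuous extension $\widetilde{\varphi}$ to $\mathcal{A}$. If $\mathcal{A}$ is $(\widetilde{\varphi},\widetilde{\varphi})$-weakly amenable, then $\mathfrak{B}$ is $(\varphi,\varphi)$-weakly amenable.
   Context: Let $(\mathcal{A},\|\cdot\|)$ be a Banach algebra. $(\mathfrak{B},\|\cdot\|')$ is an abstract Segal algebra with respect to $(\mathcal{A},\|\cdot\|)$ if: (1) $\mathfrak{B}$ is a dense left ideal in $\mathcal{A}$ and $\mathfrak{B}$ is a Banach algebra with respect to $\|\cdot\|'$; (2) there exists $M>0$ such that $\|b\|\leq M\|b\|'$ for each $b\in\mathfrak{B}$; (3) there exists $C>0$ such that $\|ab\|'\leq C\|a\|'\|b\|'$ for each $a,b\in\mathfrak{B}$. The approximate identity is one for $(\mathfrak{B},\|\cdot\|')$. $\mathrm{Hom}(A)$ denotes the set of all bounded (continuous) algebra homomorphisms $A\to A$ of a Banach algebra $A$. For $\varphi,\psi\in\mathrm{Hom}(A)$, $A_{(\varphi,\psi)}$ denotes $A$ with module actions $a\cdot x:=\varphi(a)x$, $x\cdot a:=x\psi(a)$. $A$ is $(\varphi,\psi)$-weakly amenable if $H^1(A,(A_{(\varphi,\psi)})^* )=\{0\}$, i.e. every bounded derivation from $A$ into the dual module $(A_{(\varphi,\psi)})^*$ is inner. Equivalently: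 every bounded linear $d:A\to A^*$ with $d(ab)=d(a)\cdot\varphi(b)+\psi(a)\cdot d(b)$ for all $a,b\in A$ is of the form $d(a)=\xi\cdot\varphi(a)-\psi(a)\cdot\xi$ for some $\xi\in A^*$, where $A^*$ has its natural actions $\langle f\cdot a,x\rangle=\langle f,ax\rangle$, $\langle a\cdot f,x\rangle=\langle f,xa\rangle$. *)

theory Defs
  imports "HOL-Analysis.Analysis"
begin

text \<open>
  The classes \<^class>\<open>real_normed_algebra\<close> and \<^class>\<open>banach\<close> only provide real scalars.
  A Banach algebra over \<open>'k\<close> is a type in these classes together with a compatible scalar
  multiplication \<open>sc\<close>. By the Gelfand--Mazur theorem, the fields of class
  \<^class>\<open>real_normed_field\<close> are exactly the reals and the complex numbers. Algebras need not be
  unital.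
\<close>

locale banach_algebra = vector_space sc
  for sc :: "'k::real_normed_field \<Rightarrow> 'a::{real_normed_algebra,banach} \<Rightarrow> 'a" +
  assumes scale_of_real: "sc (of_real r) x = r *\<^sub>R x"
    and norm_scale: "norm (sc c x) = norm c * norm x"
    and scale_mult_left: "sc c x * y = sc c (x * y)"
    and scale_mult_right: "x * sc c y = sc c (x * y)"

text \<open>
  A subalgebra \<open>S\<close> that is a Banach algebra for a norm \<open>N\<close> of its own. Here and below, values
  of \<open>N\<close>, and of maps and functionals on \<open>S\<close>, are irrelevant outside \<open>S\<close>.
\<close>

locale banach_algebra_on =
  fixes sc :: "'k::real_normed_field \<Rightarrow> 'a::{real_normed_algebra,banach} \<Rightarrow> 'a"
    and S :: "'a set" and N :: "'a \<Rightarrow> real"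
  assumes subspace: "module.subspace sc S"
    and mult_closed: "\<lbrakk>x \<in> S; y \<in> S\<rbrakk> \<Longrightarrow> x * y \<in> S"
    and N_nonneg: "x \<in> S \<Longrightarrow> 0 \<le> N x"
    and N_eq_0_iff: "x \<in> S \<Longrightarrow> N x = 0 \<longleftrightarrow> x = 0"
    and N_triangle: "\<lbrakk>x \<in> S; y \<in> S\<rbrakk> \<Longrightarrow> N (x + y) \<le> N x + N y"
    and N_scale: "x \<in> S \<Longrightarrow> N (sc c x) = norm c * N x"
    and N_mult: "\<lbrakk>x \<in> S; y \<in> S\<rbrakk> \<Longrightarrow> N (x * y) \<le> N x * N y"
    and complete: "\<lbrakk>\<And>n::nat. X n \<in> S; \<forall>e>0. \<exists>k. \<forall>m\<ge>k. \<forall>n\<ge>k. N (X m - X n) < e\<rbrakk>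
      \<Longrightarrow> \<exists>x\<in>S. (\<lambda>n. N (X n - x)) \<longlonglongrightarrow> 0"

lemma (in banach_algebra) banach_algebra_on_UNIV: "banach_algebra_on sc UNIV norm"
proof
  show "\<exists>x\<in>UNIV. (\<lambda>n. norm (X n - x)) \<longlonglongrightarrow> 0"
    if "\<forall>e>0. \<exists>k. \<forall>m\<ge>k. \<forall>n\<ge>k. norm (X m - X n) < e" for X :: "nat \<Rightarrow> 'a"
  proof -
    have "Cauchy X" using that by (simp add: Cauchy_def dist_norm)
    then obtain x where "X \<longlonglongrightarrow> x" by (auto simp: Cauchy_convergent_iff convergent_def)
    then show ?thesis using LIM_zero tendsto_norm_zero by blast
  qed
qed (auto simp: norm_triangle_ineq norm_scale norm_mult_ineq)

locale abstract_segal_algebra =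
  fixes sc :: "'k::real_normed_field \<Rightarrow> 'a::{real_normed_algebra,banach} \<Rightarrow> 'a"
    and B :: "'a set" and N :: "'a \<Rightarrow> real"
  assumes dense: "closure B = UNIV"
    and left_ideal: "b \<in> B \<Longrightarrow> a * b \<in> B"
    and banach: "banach_algebra_on sc B N"
    and norm_le: "\<exists>M>0. \<forall>b\<in>B. norm b \<le> M * N b"
    and N_mult_le: "\<exists>C>0. \<forall>a\<in>B. \<forall>b\<in>B. N (a * b) \<le> C * N a * N b"

definition approximate_identity ::
  "'a::ring set \<Rightarrow> ('a \<Rightarrow> real) \<Rightarrow> ('i \<Rightarrow> 'a) \<Rightarrow> 'i filter \<Rightarrow> bool"
  \<comment> \<open>nets are rendered as families indexed along a proper filter\<close>
  where "approximate_identity S N e F \<longleftrightarrow> F \<noteq> bot \<and> (\<forall>i. e i \<in> S) \<and>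
    (\<forall>x\<in>S. ((\<lambda>i. N (e i * x - x)) \<longlongrightarrow> 0) F \<and> ((\<lambda>i. N (x * e i - x)) \<longlongrightarrow> 0) F)"

definition linear_on ::
  "('k \<Rightarrow> 'a::plus \<Rightarrow> 'a) \<Rightarrow> ('k \<Rightarrow> 'b::plus \<Rightarrow> 'b) \<Rightarrow> 'a set \<Rightarrow> ('a \<Rightarrow> 'b) \<Rightarrow> bool"
  where "linear_on s t S f \<longleftrightarrow>
    (\<forall>x\<in>S. \<forall>y\<in>S. f (x + y) = f x + f y) \<and> (\<forall>c. \<forall>x\<in>S. f (s c x) = t c (f x))"

definition Hom :: "('k \<Rightarrow> 'a::ring \<Rightarrow> 'a) \<Rightarrow> 'a set \<Rightarrow> ('a \<Rightarrow> real) \<Rightarrow> ('a \<Rightarrow> 'a) set"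
  where "Hom sc S N = {\<phi>. \<phi> ` S \<subseteq> S \<and> linear_on sc sc S \<phi> \<and>
    (\<forall>x\<in>S. \<forall>y\<in>S. \<phi> (x * y) = \<phi> x * \<phi> y) \<and> (\<exists>K. \<forall>x\<in>S. N (\<phi> x) \<le> K * N x)}"

text \<open>A continuous extension of an element of \<open>Hom sc B N\<close> is automatically a bounded homomorphism.\<close>

lemma continuous_extension_in_Hom:
  fixes sc :: "'k::real_normed_field \<Rightarrow> 'a::{real_normed_algebra,banach} \<Rightarrow> 'a"
  assumes "banach_algebra sc" "abstract_segal_algebra sc B N" "\<phi> \<in> Hom sc B N"
    and cont: "continuous_on UNIV \<phi>'" and ext: "\<And>b. b \<in> B \<Longrightarrow> \<phi>' b = \<phi> b"
  shows "\<phi>' \<in> Hom sc UNIV norm"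
proof -
  interpret A: banach_algebra sc by fact
  interpret B: abstract_segal_algebra sc B N by fact
  interpret BB: banach_algebra_on sc B N by (rule B.banach)
  have sub: "x + y \<in> B" "sc c x \<in> B" if "x \<in> B" "y \<in> B" for x y c
    using that BB.subspace by (auto simp: A.subspace_def)
  have hom: "\<phi> (x + y) = \<phi> x + \<phi> y" "\<phi> (x * y) = \<phi> x * \<phi> y" "\<phi> (sc c x) = sc c (\<phi> x)"
    if "x \<in> B" "y \<in> B" for x y c
    using that assms(3) by (auto simp: Hom_def linear_on_def)
  have lim: "(\<lambda>n. \<phi>' (X n)) \<longlonglongrightarrow> \<phi>' x" if "X \<longlonglongrightarrow> x" for X :: "nat \<Rightarrow> 'a" and x
    using continuous_on_tendsto_compose[OF cont that] by simp
  have sc_lim: "(\<lambda>n. sc c (X n)) \<longlonglongrightarrow> sc c x" if "X \<longlonglongrightarrow> x" for X :: "nat \<Rightarrow> 'a" and x c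
  proof -
    have "(\<lambda>n. norm c * norm (X n - x)) \<longlonglongrightarrow> norm c * 0"
      by (intro tendsto_intros tendsto_norm_zero LIM_zero that)
    moreover have "norm (sc c (X n) - sc c x) = norm c * norm (X n - x)" for n
      by (metis A.norm_scale A.scale_right_diff_distrib)
    ultimately have "(\<lambda>n. norm (sc c (X n) - sc c x)) \<longlonglongrightarrow> 0" by simp
    then show ?thesis using LIM_zero_cancel tendsto_norm_zero_iff by blast
  qed
  have dense: "\<exists>X. (\<forall>n. X n \<in> B) \<and> X \<longlonglongrightarrow> x" for x
    using B.dense closure_sequential[of x B] by auto
  have add: "\<phi>' (x + y) = \<phi>' x + \<phi>' y" and mult: "\<phi>' (x * y) = \<phi>' x * \<phi>' y"
    and scl: "\<phi>' (sc c x) = sc c (\<phi>' x)" for x y c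
  proof -
    obtain X where X: "\<And>n. X n \<in> B" "X \<longlonglongrightarrow> x" using dense by blast
    obtain Y where Y: "\<And>n. Y n \<in> B" "Y \<longlonglongrightarrow> y" using dense by blast
    note L = lim[OF X(2)] lim[OF Y(2)]
    have "(\<lambda>n. \<phi>' (X n + Y n)) \<longlonglongrightarrow> \<phi>' (x + y)" by (intro lim tendsto_add X Y)
    moreover have "\<phi>' (X n + Y n) = \<phi>' (X n) + \<phi>' (Y n)" for n
      using X(1)[of n] Y(1)[of n] by (simp add: ext sub hom)
    ultimately show "\<phi>' (x + y) = \<phi>' x + \<phi>' y"
      using tendsto_add[OF L] LIMSEQ_unique by fastforce
    have "(\<lambda>n. \<phi>' (X n * Y n)) \<longlonglongrightarrow> \<phi>' (x * y)" by (intro lim tendsto_mult X Y)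
    moreover have "\<phi>' (X n * Y n) = \<phi>' (X n) * \<phi>' (Y n)" for n
      using X(1)[of n] Y(1)[of n] by (simp add: ext BB.mult_closed hom)
    ultimately show "\<phi>' (x * y) = \<phi>' x * \<phi>' y"
      using tendsto_mult[OF L] LIMSEQ_unique by fastforce
    have "(\<lambda>n. \<phi>' (sc c (X n))) \<longlonglongrightarrow> \<phi>' (sc c x)" by (intro lim sc_lim X)
    moreover have "\<phi>' (sc c (X n)) = sc c (\<phi>' (X n))" for n
      using X(1)[of n] by (metis ext sub(2) hom(3))
    ultimately show "\<phi>' (sc c x) = sc c (\<phi>' x)"
      using sc_lim[OF L(1), of c] LIMSEQ_unique by fastforce
  qed
  have lin: "\<phi>' (r *\<^sub>R x) = r *\<^sub>R \<phi>' x" for r x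
    using scl[of "of_real r" x] by (simp add: A.scale_of_real)
  have z: "\<phi>' 0 = 0" using lin[of 0 0] by simp
  obtain \<delta> where d: "\<delta> > 0" "\<And>x. norm x < \<delta> \<Longrightarrow> norm (\<phi>' x) < 1"
    using cont[unfolded continuous_on_iff, rule_format, of 0 1] z by (auto simp: dist_norm)
  have "norm (\<phi>' x) \<le> 2 / \<delta> * norm x" for x
  proof (cases "x = 0")
    case False
    define r where "r = \<delta> / (2 * norm x)"
    have r: "r > 0" using d False by (simp add: r_def)
    have "norm (r *\<^sub>R x) < \<delta>" using d False by (simp add: r_def)
    then have "r * norm (\<phi>' x) < 1" using d(2)[of "r *\<^sub>R x"] r by (simp add: lin)
    then have "norm (\<phi>' x) < 1 / r" using r by (simp add: field_simps)
    then show ?thesis by (simp add: r_def)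
  qed (simp add: z)
  then have "\<exists>K. \<forall>x. norm (\<phi>' x) \<le> K * norm x" by blast
  then show ?thesis using add mult scl by (simp add: Hom_def linear_on_def)
qed

definition dual ::
  "('k::real_normed_field \<Rightarrow> 'a::plus \<Rightarrow> 'a) \<Rightarrow> 'a set \<Rightarrow> ('a \<Rightarrow> real) \<Rightarrow> ('a \<Rightarrow> 'k) set"
  where "dual sc S N =
    {f. linear_on sc (*) S f \<and> (\<exists>K. \<forall>x\<in>S. norm (f x) \<le> K * N x)}"

definition dual_norm :: "'a set \<Rightarrow> ('a \<Rightarrow> real) \<Rightarrow> ('a \<Rightarrow> 'k::real_normed_field) \<Rightarrow> real"
  where "dual_norm S N f = (SUP x\<in>{x\<in>S. N x \<le> 1}. norm (f x))"

text \<open>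
  The module actions \<open>a \<cdot> x = \<phi> a * x\<close> and \<open>x \<cdot> a = x * \<psi> a\<close> on \<open>S\<close>, and the actions they induce
  on functionals: \<open>(a \<cdot> f) x = f (x \<cdot> a)\<close> and \<open>(f \<cdot> a) x = f (a \<cdot> x)\<close>.
\<close>

definition lact :: "('a::times \<Rightarrow> 'a) \<Rightarrow> 'a \<Rightarrow> 'a \<Rightarrow> 'a"
  where "lact \<phi> a x = \<phi> a * x"

definition ract :: "('a::times \<Rightarrow> 'a) \<Rightarrow> 'a \<Rightarrow> 'a \<Rightarrow> 'a"
  where "ract \<psi> x a = x * \<psi> a"

definition dual_lact :: "('a::times \<Rightarrow> 'a) \<Rightarrow> 'a \<Rightarrow> ('a \<Rightarrow> 'k) \<Rightarrow> 'a \<Rightarrow> 'k"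
  where "dual_lact \<psi> a f = (\<lambda>x. f (ract \<psi> x a))"

definition dual_ract :: "('a::times \<Rightarrow> 'a) \<Rightarrow> ('a \<Rightarrow> 'k) \<Rightarrow> 'a \<Rightarrow> 'a \<Rightarrow> 'k"
  where "dual_ract \<phi> f a = (\<lambda>x. f (lact \<phi> a x))"

definition bounded_derivation ::
  "('k::real_normed_field \<Rightarrow> 'a::ring \<Rightarrow> 'a) \<Rightarrow> 'a set \<Rightarrow> ('a \<Rightarrow> real) \<Rightarrow>
    ('a \<Rightarrow> 'a) \<Rightarrow> ('a \<Rightarrow> 'a) \<Rightarrow> ('a \<Rightarrow> 'a \<Rightarrow> 'k) \<Rightarrow> bool"
  where "bounded_derivation sc S N \<phi> \<psi> d \<longleftrightarrow>
    d ` S \<subseteq> dual sc S N \<and>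
    (\<forall>a\<in>S. \<forall>b\<in>S. \<forall>x\<in>S. d (a + b) x = d a x + d b x) \<and>
    (\<forall>c. \<forall>a\<in>S. \<forall>x\<in>S. d (sc c a) x = c * d a x) \<and>
    (\<exists>K. \<forall>a\<in>S. dual_norm S N (d a) \<le> K * N a) \<and>
    (\<forall>a\<in>S. \<forall>b\<in>S. \<forall>x\<in>S. d (a * b) x = dual_ract \<phi> (d a) b x + dual_lact \<psi> a (d b) x)"

definition inner_derivation ::
  "('k::real_normed_field \<Rightarrow> 'a::ring \<Rightarrow> 'a) \<Rightarrow> 'a set \<Rightarrow> ('a \<Rightarrow> real) \<Rightarrow>
    ('a \<Rightarrow> 'a) \<Rightarrow> ('a \<Rightarrow> 'a) \<Rightarrow> ('a \<Rightarrow> 'a \<Rightarrow> 'k) \<Rightarrow> bool"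
  where "inner_derivation sc S N \<phi> \<psi> d \<longleftrightarrow>
    (\<exists>\<xi>\<in>dual sc S N. \<forall>a\<in>S. \<forall>x\<in>S. d a x = dual_ract \<phi> \<xi> a x - dual_lact \<psi> a \<xi> x)"

definition weakly_amenable ::
  "('k::real_normed_field \<Rightarrow> 'a::ring \<Rightarrow> 'a) \<Rightarrow> 'a set \<Rightarrow> ('a \<Rightarrow> real) \<Rightarrow>
    ('a \<Rightarrow> 'a) \<Rightarrow> ('a \<Rightarrow> 'a) \<Rightarrow> bool"
  where "weakly_amenable sc S N \<phi> \<psi> \<longleftrightarrow>
    (\<forall>d. bounded_derivation sc S N \<phi> \<psi> d \<longrightarrow> inner_derivation sc S N \<phi> \<psi> d)"

end

theory Submission imports Defs begin

text \<open>
  The map \<open>a \<mapsto> a * b\<close> from \<open>A\<close> into \<open>(B, N)\<close> has closed graph, so \<open>N (a * b) \<le> C\<^sub>b * norm a\<close>.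
  Hence, for a bounded derivation \<open>D\<close> on \<open>B\<close> and fixed \<open>b, y \<in> B\<close>,
  \<open>d a x = D (a * b) (x * y) - D b (\<phi>' a * (x * y))\<close> is a bounded bilinear form on \<open>A\<close>. On \<open>B\<close>
  it equals \<open>D a (\<phi> b * (x * y))\<close>; by density it is a derivation on \<open>A\<close>, so it is inner, that is,
  zero, because \<open>A\<close> is commutative. Letting \<open>x\<close> run through the approximate identity gives
  \<open>D a (\<phi> b * y) = 0\<close>, hence \<open>D (a * b) = 0\<close> for all \<open>a, b \<in> B\<close>, and a second use of the
  approximate identity gives \<open>D = 0\<close>.
\<close>

text \<open>Zabreiko's lemma, which takes the place of the closed graph theorem below.\<close>

lemma countably_subadditive_seminorm_bounded:
  fixes p :: "'a::banach \<Rightarrow> real"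
  assumes nonneg: "\<And>x. 0 \<le> p x"
    and triangle: "\<And>x y. p (x + y) \<le> p x + p y"
    and scale: "\<And>r x. p (r *\<^sub>R x) = \<bar>r\<bar> * p x"
    and suminf: "\<And>u x. \<lbrakk>u sums x; summable (\<lambda>n. p (u n))\<rbrakk> \<Longrightarrow> p x \<le> (\<Sum>n. p (u n))"
  obtains C where "0 \<le> C" "\<And>x. p x \<le> C * norm x"
proof -
  \<comment> \<open>\<open>p\<close> is not known to be continuous, so Baire's theorem is applied to
    closures of sublevel sets. Points of \<open>V n\<close> are therefore only approximated by
    vectors on which \<open>p\<close> is at most \<open>n\<close>.\<close>
  define V where "V n = closure {x. p x \<le> real n}" for n
  have "\<exists>n. x \<in> V n" for x
    using real_arch_simple[of "p x"] by (auto simp: V_def intro: subsetD[OF closure_subset])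
  then have cover: "(\<Union>n. V n) = UNIV" by auto
  have "\<exists>n. interior (V n) \<noteq> {}"
  proof (rule ccontr)
    assume none: "\<nexists>n. interior (V n) \<noteq> {}"
    have "Met_TC.mtopology interior_of \<Union>(range V) = {}"
      by (rule Met_TC.metric_Baire_category_alt)
        (use none in \<open>auto simp: complete_UNIV V_def\<close>)
    then show False by (simp add: cover)
  qed
  then obtain n x0 where "x0 \<in> interior (V n)" by blast
  then obtain r where r: "r > 0" "cball x0 r \<subseteq> V n"
    by (meson mem_interior_cball)
  \<comment> \<open>The ball about \<open>x0\<close> is moved to the origin: half the difference of
    approximants of \<open>x0 + z\<close> and \<open>x0 - z\<close> lies near \<open>z\<close>, and
    \<open>p\<close> is still at most \<open>n\<close> on it by homogeneity and the triangle
    inequality.\<close>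
  have near: "\<exists>u. p u \<le> real n \<and> norm (z - u) < \<epsilon>" if "norm z \<le> r" "\<epsilon> > 0" for z \<epsilon>
  proof -
    have "x0 + z \<in> V n" "x0 - z \<in> V n"
      using r that by (auto simp: subset_iff dist_norm)
    then obtain u v where uv: "p u \<le> real n" "dist u (x0 + z) < \<epsilon>" "p v \<le> real n" "dist v (x0 - z) < \<epsilon>"
      using \<open>\<epsilon> > 0\<close> unfolding V_def closure_approachable by blast
    define w where "w = (1/2) *\<^sub>R u + (-1/2) *\<^sub>R v"
    have "p w \<le> real n"
      using triangle[of "(1/2) *\<^sub>R u" "(-1/2) *\<^sub>R v"] uv
      unfolding scale w_def by simp
    moreover have "z - w = (1/2) *\<^sub>R (((x0 + z) - u) - ((x0 - z) - v))"
      by (simp add: w_def algebra_simps flip: scaleR_add_left)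
    then have "norm (z - w) \<le> 1/2 * (norm ((x0 + z) - u) + norm ((x0 - z) - v))"
      using norm_triangle_ineq4[of "(x0 + z) - u" "(x0 - z) - v"] by simp
    then have "norm (z - w) < \<epsilon>"
      using uv by (simp add: dist_norm norm_minus_commute)
    ultimately show ?thesis by blast
  qed
  define M where "M = real n / r"
  have M: "M \<ge> 0" using r by (simp add: M_def)
  have p0: "p 0 = 0" using scale[of 0 0] by simp
  \<comment> \<open>Rescale \<open>z\<close> to norm \<open>r\<close>, approximate within
    \<open>r / 2\<close> and scale back: the relative error is 1/2, and the cost in \<open>p\<close>
    is \<open>n / r\<close> times \<open>norm z\<close>.\<close>
  have approx: "\<exists>u. p u \<le> M * norm z \<and> norm (z - u) \<le> norm z / 2" for z
  proof (cases "z = 0")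
    case False
    define t where "t = r / norm z"
    have t: "t > 0" "norm (t *\<^sub>R z) = r" using r False by (auto simp: t_def)
    obtain u where u: "p u \<le> real n" "norm (t *\<^sub>R z - u) < r / 2"
      using near[of "t *\<^sub>R z" "r/2"] t r by auto
    have small: "p ((1/t) *\<^sub>R u) \<le> M * norm z"
      using u t r False by (simp add: scale M_def t_def field_simps)
    have "z - (1/t) *\<^sub>R u = (1/t) *\<^sub>R (t *\<^sub>R z - u)"
      using t by (simp add: algebra_simps)
    then have "norm (z - (1/t) *\<^sub>R u) = norm (t *\<^sub>R z - u) / t"
      using t by simp
    also have "\<dots> \<le> (r / 2) / t"
      using u t by (intro divide_right_mono) auto
    also have "\<dots> = norm z / 2" using r by (simp add: t_def)
    finally have "norm (z - (1/t) *\<^sub>R u) \<le> norm z / 2" .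
    with small show ?thesis by blast
  qed (use p0 in auto)
  then obtain g where g: "\<And>z. p (g z) \<le> M * norm z" "\<And>z. norm (z - g z) \<le> norm z / 2"
    by metis
  have "p x \<le> (2 * M) * norm x" for x
  proof -
    \<comment> \<open>\<open>y k\<close> is the remainder after \<open>k\<close> corrections. Its
      norm is at least halved each time, so the corrections \<open>g (y k)\<close> sum to
      \<open>x\<close>, while their \<open>p\<close>-values are dominated by a geometric series with
      sum \<open>2 * M * norm x\<close>; \<open>suminf\<close> then bounds
      \<open>p x\<close>.\<close>
    define y where "y k = ((\<lambda>z. z - g z) ^^ k) x" for k
    have y0: "y 0 = x" and ySuc: "y (Suc k) = y k - g (y k)" for k
      by (auto simp: y_def)
    have ny: "norm (y k) \<le> norm x * (1/2) ^ k" for k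
    proof (induction k)
      case (Suc k)
      then show ?case using g(2)[of "y k"] by (simp add: ySuc)
    qed (simp add: y0)
    have half: "(\<lambda>k. (1/2::real) ^ k) sums 2"
      using geometric_sums[of "1/2::real"] by simp
    have ps: "p (g (y k)) \<le> M * norm x * (1/2) ^ k" for k
      using g(1)[of "y k"] mult_left_mono[OF ny M, of k] by (simp add: mult.assoc)
    have S: "(\<lambda>k. M * norm x * (1/2) ^ k) sums (M * norm x * 2)"
      by (intro sums_mult half)
    have summ: "summable (\<lambda>k. p (g (y k)))"
      by (rule summable_comparison_test[OF _ sums_summable[OF S]]) (use ps nonneg in auto)
    have "y \<longlonglongrightarrow> 0"
    proof (rule Lim_null_comparison)
      show "\<forall>\<^sub>F k in sequentially. norm (y k) \<le> norm x * (1/2) ^ k" using ny by simp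
      have "(\<lambda>k. norm x * (1/2) ^ k) \<longlonglongrightarrow> norm x * 0"
        by (intro tendsto_mult LIMSEQ_power_zero tendsto_const) simp
      then show "(\<lambda>k. norm x * (1/2) ^ k) \<longlonglongrightarrow> 0" by simp
    qed
    then have "(\<lambda>k. y k - y (Suc k)) sums (y 0 - 0)" by (rule telescope_sums')
    then have "(\<lambda>k. g (y k)) sums x" by (simp add: ySuc y0)
    from suminf[OF this summ] have "p x \<le> (\<Sum>k. p (g (y k)))" .
    also have "\<dots> \<le> M * norm x * 2"
      using suminf_le[OF ps summ sums_summable[OF S]] sums_unique[OF S] by simp
    finally show ?thesis by (simp add: mult_ac)
  qed
  then show thesis using that[of "2 * M"] M by simp
qed

section \<open>The Segal norm: series, multiplication and functionals\<close>

context
  fixes sc :: "'k::real_normed_field \<Rightarrow> 'a::{real_normed_algebra,banach} \<Rightarrow> 'a"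
    and B :: "'a set" and N :: "'a \<Rightarrow> real"
  assumes algebra: "banach_algebra sc" and segal: "abstract_segal_algebra sc B N"
begin

interpretation A: banach_algebra sc by (rule algebra)
interpretation B: abstract_segal_algebra sc B N by (rule segal)
interpretation BB: banach_algebra_on sc B N by (rule B.banach)

lemma segal_scale: "x \<in> B \<Longrightarrow> sc c x \<in> B"
  and segal_0: "0 \<in> B"
  using BB.subspace by (auto simp: A.subspace_def)

lemma segal_scaleR: "x \<in> B \<Longrightarrow> r *\<^sub>R x \<in> B"
  using segal_scale[of x "of_real r"] by (simp add: A.scale_of_real)

lemma segal_diff: "\<lbrakk>x \<in> B; y \<in> B\<rbrakk> \<Longrightarrow> x - y \<in> B"
  using BB.subspace A.subspace_diff by blast

lemma segal_sum: "(\<And>i. i \<in> I \<Longrightarrow> f i \<in> B) \<Longrightarrow> sum f I \<in> B"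
  using BB.subspace A.subspace_sum by blast

lemma segal_norm_scaleR: "x \<in> B \<Longrightarrow> N (r *\<^sub>R x) = \<bar>r\<bar> * N x"
  using BB.N_scale[of x "of_real r"] by (simp add: A.scale_of_real)

lemma segal_norm_minus_commute: "\<lbrakk>x \<in> B; y \<in> B\<rbrakk> \<Longrightarrow> N (x - y) = N (y - x)"
  using segal_norm_scaleR[of "x - y" "-1"] segal_diff by simp

lemma segal_norm_sum: "(\<And>i. i \<in> I \<Longrightarrow> f i \<in> B) \<Longrightarrow> N (sum f I) \<le> (\<Sum>i\<in>I. N (f i))"
proof (induction I rule: infinite_finite_induct)
  case (insert i I)
  have "N (f i + sum f I) \<le> N (f i) + N (sum f I)"
    using insert.prems by (intro BB.N_triangle segal_sum) auto
  then show ?case using insert by fastforce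
qed (use BB.N_eq_0_iff[OF segal_0] in simp_all)

text \<open>The partial sums are Cauchy for \<open>N\<close>, so completeness gives an
  \<open>N\<close>-limit in \<open>B\<close>. Since a multiple of \<open>N\<close> dominates the
  norm, that limit is also the norm limit, hence \<open>s\<close>. This provides the countable
  subadditivity needed for Zabreiko's lemma.\<close>

lemma segal_summable_suminf:
  assumes f: "\<And>n. f n \<in> B" and summ: "summable (\<lambda>n. N (f n))" and sums: "f sums s"
  shows "s \<in> B" "N s \<le> (\<Sum>n. N (f n))"
proof -
  define S where "S n = sum f {..<n}" for n
  define P where "P n = (\<Sum>i<n. N (f i))" for n
  have SB: "S n \<in> B" for n using f by (auto simp: S_def intro: segal_sum)
  have dle: "N (S m - S n) \<le> \<bar>P m - P n\<bar>" if "n \<le> m" for m n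
  proof -
    have "S m - S n = sum f {n..<m}" "P m - P n = (\<Sum>i=n..<m. N (f i))"
      using that by (simp_all add: S_def P_def sum_diff_nat_ivl[of 0 n m, simplified atLeast0LessThan])
    then show ?thesis using segal_norm_sum[of "{n..<m}" f] f by fastforce
  qed
  \<comment> \<open>The absolute value makes the estimate symmetric in \<open>m\<close> and
    \<open>n\<close>, which the Cauchy condition requires.\<close>
  have dle: "N (S m - S n) \<le> \<bar>P m - P n\<bar>" for m n
    using dle[of n m] dle[of m n] segal_norm_minus_commute[OF SB SB, of n m]
    by (cases "n \<le> m") (auto simp: abs_minus_commute)
  have Plim: "P \<longlonglongrightarrow> (\<Sum>n. N (f n))"
    unfolding P_def using summ by (rule summable_LIMSEQ)
  have "Cauchy P" using Plim LIMSEQ_imp_Cauchy by blast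
  then have "\<forall>e>0. \<exists>k. \<forall>m\<ge>k. \<forall>n\<ge>k. N (S m - S n) < e"
    unfolding Cauchy_def dist_real_def using dle by (meson le_less_trans)
  then obtain c where c: "c \<in> B" "(\<lambda>n. N (S n - c)) \<longlonglongrightarrow> 0"
    using BB.complete[of S] SB by blast
  obtain M where M: "\<And>b. b \<in> B \<Longrightarrow> norm b \<le> M * N b" using B.norm_le by blast
  have "(\<lambda>n. S n - c) \<longlonglongrightarrow> 0"
  proof (rule Lim_null_comparison)
    show "\<forall>\<^sub>F n in sequentially. norm (S n - c) \<le> M * N (S n - c)"
      using M SB c(1) segal_diff by simp
    show "(\<lambda>n. M * N (S n - c)) \<longlonglongrightarrow> 0" using tendsto_mult_left[OF c(2), of M] by simp
  qed
  then have "S \<longlonglongrightarrow> c" by (rule LIM_zero_cancel)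
  moreover have "S \<longlonglongrightarrow> s" using sums by (simp add: sums_def S_def[abs_def])
  ultimately have cs: "c = s" by (rule LIMSEQ_unique)
  then show "s \<in> B" using c by simp
  have "N s \<le> P n + N (S n - s)" for n
  proof -
    have "N (S n + (s - S n)) \<le> N (S n) + N (s - S n)"
      by (intro BB.N_triangle segal_diff SB) (use c cs in auto)
    moreover have "N (S n) \<le> P n" unfolding S_def P_def using f by (intro segal_norm_sum)
    ultimately show ?thesis
      using segal_norm_minus_commute[OF SB \<open>s \<in> B\<close>, of n] by simp
  qed
  moreover have "(\<lambda>n. P n + N (S n - s)) \<longlonglongrightarrow> (\<Sum>n. N (f n)) + 0"
    using Plim c cs by (intro tendsto_add) auto
  ultimately show "N s \<le> (\<Sum>n. N (f n))"
    using LIMSEQ_le_const[of _ "(\<Sum>n. N (f n)) + 0" "N s"] by simp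
qed

text \<open>Right multiplication by \<open>b\<close> sends a norm-convergent series to one with
  terms and sum in \<open>B\<close>, so \<open>a \<mapsto> N (a * b)\<close> is a countably
  subadditive seminorm. The bound by \<open>norm a\<close>, not \<open>N a\<close>, is what lets
  limits in \<open>A\<close> pass to \<open>B\<close>.\<close>

lemma segal_mult_bounded:
  assumes b: "b \<in> B"
  obtains C where "0 \<le> C" "\<And>a. N (a * b) \<le> C * norm a"
proof (rule countably_subadditive_seminorm_bounded[of "\<lambda>a. N (a * b)"])
  note ideal = B.left_ideal[OF b]
  show "0 \<le> N (a * b)" for a using ideal by (rule BB.N_nonneg)
  show "N ((x + y) * b) \<le> N (x * b) + N (y * b)" for x y
    unfolding distrib_right using ideal by (intro BB.N_triangle)
  show "N ((r *\<^sub>R x) * b) = \<bar>r\<bar> * N (x * b)" for r x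
    using segal_norm_scaleR[OF ideal, of r x] by simp
  show "N (x * b) \<le> (\<Sum>n. N (u n * b))" if "u sums x" "summable (\<lambda>n. N (u n * b))" for u x
    using segal_summable_suminf(2)[of "\<lambda>n. u n * b"] that ideal sums_mult2 by blast
qed (use that in blast)

text \<open>A real supremum is an upper bound only when the values are bounded above; membership in
  \<open>dual\<close> ensures this, and the rest is normalisation of \<open>x\<close>.\<close>

lemma dual_norm_bound:
  assumes f: "f \<in> dual sc B N" and x: "x \<in> B"
  shows "norm (f x) \<le> dual_norm B N f * N x"
proof (cases "N x = 0")
  case True
  then show ?thesis using f x by (fastforce simp: dual_def)
next
  case False
  then have pos: "N x > 0" using BB.N_nonneg[OF x] by simp
  define y where "y = (1 / N x) *\<^sub>R x"
  have y: "y \<in> B" "N y = 1"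
    using pos x by (auto simp: y_def segal_scaleR segal_norm_scaleR)
  obtain K where K: "\<And>x. x \<in> B \<Longrightarrow> norm (f x) \<le> K * N x"
    using f by (auto simp: dual_def)
  have "norm (f z) \<le> \<bar>K\<bar>" if "z \<in> B" "N z \<le> 1" for z
  proof -
    have "K * N z \<le> \<bar>K\<bar> * 1"
      using that BB.N_nonneg[of z] by (intro mult_mono) auto
    then show ?thesis using K[OF that(1)] by simp
  qed
  then have "bdd_above ((\<lambda>x. norm (f x)) ` {x \<in> B. N x \<le> 1})"
    by (auto intro!: bdd_aboveI)
  then have "norm (f y) \<le> dual_norm B N f"
    unfolding dual_norm_def using y by (intro cSUP_upper) auto
  moreover have "f y = of_real (1 / N x) * f x"
    using f x unfolding dual_def linear_on_def y_def
    by (simp flip: A.scale_of_real del: of_real_divide)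
  ultimately show ?thesis using pos by (simp add: norm_mult norm_divide field_simps)
qed

end

section \<open>Transfer of weak amenability from \<open>A\<close> to \<open>B\<close>\<close>

theorem theorem3p2:
  fixes sc :: "'k::real_normed_field \<Rightarrow> 'a::{real_normed_algebra,banach} \<Rightarrow> 'a"
    and B :: "'a set" and N :: "'a \<Rightarrow> real"
    and e :: "'i \<Rightarrow> 'a" and F :: "'i filter"
    and \<phi> \<phi>' :: "'a \<Rightarrow> 'a"
  assumes "banach_algebra sc"
    and commutative: "\<And>x y :: 'a. x * y = y * x"
    and "abstract_segal_algebra sc B N"
    and "approximate_identity B N e F"
    and "\<phi> \<in> Hom sc B N"
    and "continuous_on UNIV \<phi>'" and extends: "\<And>b. b \<in> B \<Longrightarrow> \<phi>' b = \<phi> b"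
    and "weakly_amenable sc UNIV norm \<phi>' \<phi>'"
  shows "weakly_amenable sc B N \<phi> \<phi>"
  unfolding weakly_amenable_def
proof (intro allI impI)
  interpret A: banach_algebra sc by fact
  interpret B: abstract_segal_algebra sc B N by fact
  interpret BB: banach_algebra_on sc B N by (rule B.banach)
  note seg = \<open>banach_algebra sc\<close> \<open>abstract_segal_algebra sc B N\<close>
  note ideal = B.left_ideal
  have left_commute: "x * (y * z) = y * (x * z)" for x y z :: 'a
    using commutative mult.assoc by metis
  have hom': "\<phi>' \<in> Hom sc UNIV norm" using assms continuous_extension_in_Hom by blast
  have add': "\<phi>' (x + y) = \<phi>' x + \<phi>' y" and mult': "\<phi>' (x * y) = \<phi>' x * \<phi>' y"
    and scale': "\<phi>' (sc c x) = sc c (\<phi>' x)" for x y c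
    using hom' by (auto simp: Hom_def linear_on_def)
  obtain L where L: "\<And>x. norm (\<phi>' x) \<le> L * norm x" using hom' by (auto simp: Hom_def)
  have F: "F \<noteq> bot" and eB: "\<And>i. e i \<in> B"
    and e_lim: "\<And>x. x \<in> B \<Longrightarrow> ((\<lambda>i. N (e i * x - x)) \<longlongrightarrow> 0) F"
    using assms(4) by (auto simp: approximate_identity_def)
  fix D assume der: "bounded_derivation sc B N \<phi> \<phi> D"
  have Ddual: "D a \<in> dual sc B N" if "a \<in> B" for a
    using der that by (auto simp: bounded_derivation_def)
  have D_add1: "D (a + b) x = D a x + D b x" and D_scale1: "D (sc c a) x = c * D a x"
    and D_add2: "D x (a + b) = D x a + D x b" and D_scale2: "D x (sc c a) = c * D x a"
    if "a \<in> B" "b \<in> B" "x \<in> B" for a b x c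
    using that der Ddual[of x] by (auto simp: bounded_derivation_def dual_def linear_on_def)
  \<comment> \<open>Commutativity turns both module actions into left multiplication, and
    \<open>\<phi>\<close> is replaced by its extension so that later arguments may leave
    \<open>B\<close>.\<close>
  have D_mult: "D (a * b) x = D a (\<phi>' b * x) + D b (\<phi>' a * x)"
    if "a \<in> B" "b \<in> B" "x \<in> B" for a b x
    using that der
    by (simp add: bounded_derivation_def dual_ract_def lact_def dual_lact_def ract_def extends
        commutative[of x])
  obtain K where K: "\<And>a. a \<in> B \<Longrightarrow> dual_norm B N (D a) \<le> K * N a"
    using der unfolding bounded_derivation_def by blast
  have Kb: "norm (D a x) \<le> K * N a * N x" if "a \<in> B" "x \<in> B" for a x
    using dual_norm_bound[OF seg Ddual that(2)] that K[of a] BB.N_nonneg[of x]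
    by (meson mult_right_mono order_trans)
  have D_diff1: "D (a - b) x = D a x - D b x" and D_diff2: "D x (a - b) = D x a - D x b"
    if "a \<in> B" "b \<in> B" "x \<in> B" for a b x
    using D_add1[of "a - b" b x] D_add2[of "a - b" b x] segal_diff[OF seg] that by auto
  \<comment> \<open>The filter \<open>G\<close> is arbitrary because the limit is needed both along
    sequences and along the approximate identity.\<close>
  have lim2: "((\<lambda>i. D a (f i)) \<longlongrightarrow> D a x) G"
    if "a \<in> B" "\<And>i. f i \<in> B" "x \<in> B" "((\<lambda>i. N (f i - x)) \<longlongrightarrow> 0) G" for a x G and f :: "'c \<Rightarrow> 'a"
  proof (rule LIM_zero_cancel, rule Lim_null_comparison)
    show "\<forall>\<^sub>F i in G. norm (D a (f i) - D a x) \<le> K * N a * N (f i - x)"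
      using Kb[OF that(1) segal_diff[OF seg that(2,3)]] D_diff2[OF that(2,3,1)]
      by (intro always_eventually allI) simp
    show "((\<lambda>i. K * N a * N (f i - x)) \<longlongrightarrow> 0) G"
      using tendsto_mult_left[OF that(4), of "K * N a"] by simp
  qed
  have lim1: "((\<lambda>i. D (f i) x) \<longlongrightarrow> D a x) G"
    if "a \<in> B" "\<And>i. f i \<in> B" "x \<in> B" "((\<lambda>i. N (f i - a)) \<longlongrightarrow> 0) G" for a x G and f :: "'c \<Rightarrow> 'a"
  proof (rule LIM_zero_cancel, rule Lim_null_comparison)
    show "\<forall>\<^sub>F i in G. norm (D (f i) x - D a x) \<le> K * N x * N (f i - a)"
      using Kb[OF segal_diff[OF seg that(2,1)] that(3)] D_diff1[OF that(2,1,3)]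
      by (intro always_eventually allI) (simp add: mult_ac)
    show "((\<lambda>i. K * N x * N (f i - a)) \<longlongrightarrow> 0) G"
      using tendsto_mult_left[OF that(4), of "K * N x"] by simp
  qed
  \<comment> \<open>A factor \<open>b\<close> in \<open>B\<close> upgrades norm convergence in
    \<open>A\<close> to \<open>N\<close>-convergence; this drives all the density arguments
    below.\<close>
  have mult_lim: "(\<lambda>n. N (X n * b - a * b)) \<longlonglongrightarrow> 0"
    if "X \<longlonglongrightarrow> a" "b \<in> B" for X :: "nat \<Rightarrow> 'a" and a b
  proof -
    obtain C where C: "\<And>a. N (a * b) \<le> C * norm a"
      using segal_mult_bounded[OF seg \<open>b \<in> B\<close>] by blast
    show ?thesis
    proof (rule Lim_null_comparison)
      show "\<forall>\<^sub>F n in sequentially. norm (N (X n * b - a * b)) \<le> C * norm (X n - a)"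
        using C ideal[OF \<open>b \<in> B\<close>] BB.N_nonneg by (auto simp flip: left_diff_distrib)
      show "(\<lambda>n. C * norm (X n - a)) \<longlonglongrightarrow> 0"
        using tendsto_mult_left[OF tendsto_norm_zero[OF LIM_zero[OF that(1)]], of C] by simp
    qed
  qed

  \<comment> \<open>The derivation on \<open>A\<close> induced by \<open>D\<close>\<close>
  have key: "D a (\<phi>' b * (x * y)) = 0" if "a \<in> B" "b \<in> B" "y \<in> B" for a b x y
  proof -
    \<comment> \<open>Solving the product rule for \<open>D a (\<phi>' b * z)\<close> gives an
      expression that makes sense for every \<open>a\<close> in \<open>A\<close>, since
      \<open>a * b\<close> and \<open>\<phi>' a * z\<close> stay in the ideal
      \<open>B\<close>.\<close>
    define E where "E a z = D (a * b) z - D b (\<phi>' a * z)" for a z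
    have E_B: "E a z = D a (\<phi>' b * z)" if "a \<in> B" "z \<in> B" for a z
      using D_mult[OF that(1) \<open>b \<in> B\<close> that(2)] by (simp add: E_def)
    have E_lim: "(\<lambda>n. E (X n) z) \<longlonglongrightarrow> E a z" if "X \<longlonglongrightarrow> a" "z \<in> B" for X :: "nat \<Rightarrow> 'a" and a z
      unfolding E_def
    proof (intro tendsto_diff lim1 lim2 mult_lim that \<open>b \<in> B\<close> ideal)
      show "(\<lambda>n. \<phi>' (X n)) \<longlonglongrightarrow> \<phi>' a"
        using continuous_on_tendsto_compose[OF assms(6) that(1)] by simp
    qed
    \<comment> \<open>First for \<open>u\<close> and \<open>v\<close> in \<open>B\<close>, by the
      product rule for \<open>D\<close>; then density extends it in \<open>u\<close>, and afterwards
      in \<open>v\<close>.\<close>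
    have E_mult: "E (u * v) z = E u (\<phi>' v * z) + E v (\<phi>' u * z)" if z: "z \<in> B" for u v z
    proof -
      have BB_case: "E (u * v) z = E u (\<phi>' v * z) + E v (\<phi>' u * z)" if "u \<in> B" "v \<in> B" for u v
        using that z \<open>b \<in> B\<close> ideal BB.mult_closed
        by (simp add: E_B D_mult left_commute[of "\<phi>' b"])
      \<comment> \<open>Continuity in the second argument is available only through the factor
        \<open>z\<close> in \<open>B\<close>.\<close>
      have E_lim2: "(\<lambda>n. E a (X n * z)) \<longlonglongrightarrow> E a (c * z)" if "X \<longlonglongrightarrow> c" for X :: "nat \<Rightarrow> 'a" and a c
      proof -
        have "(\<lambda>n. D b ((\<phi>' a * X n) * z)) \<longlonglongrightarrow> D b ((\<phi>' a * c) * z)"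
          by (intro lim2 mult_lim tendsto_mult_left that z \<open>b \<in> B\<close> ideal)
        moreover have "(\<lambda>n. D (a * b) (X n * z)) \<longlonglongrightarrow> D (a * b) (c * z)"
          by (intro lim2 mult_lim that z \<open>b \<in> B\<close> ideal)
        ultimately show ?thesis
          unfolding E_def mult.assoc by (intro tendsto_diff)
      qed
      have \<phi>'_lim: "(\<lambda>n. \<phi>' (X n)) \<longlonglongrightarrow> \<phi>' c" if "X \<longlonglongrightarrow> c" for X :: "nat \<Rightarrow> 'a" and c
        using continuous_on_tendsto_compose[OF assms(6) that] by simp
      obtain X where X: "\<And>n. X n \<in> B" "X \<longlonglongrightarrow> u"
        using B.dense closure_sequential[of u B] by auto
      obtain Y where Y: "\<And>n. Y n \<in> B" "Y \<longlonglongrightarrow> v"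
        using B.dense closure_sequential[of v B] by auto
      have half: "E (u * w) z = E u (\<phi>' w * z) + E w (\<phi>' u * z)" if "w \<in> B" for w
      proof (rule LIMSEQ_unique)
        show "(\<lambda>n. E (X n * w) z) \<longlonglongrightarrow> E (u * w) z"
          by (intro E_lim tendsto_mult_right X z)
        show "(\<lambda>n. E (X n * w) z) \<longlonglongrightarrow> E u (\<phi>' w * z) + E w (\<phi>' u * z)"
          unfolding BB_case[OF X(1) that]
          by (intro tendsto_add E_lim E_lim2 \<phi>'_lim X ideal z)
      qed
      show ?thesis
      proof (rule LIMSEQ_unique)
        show "(\<lambda>n. E (u * Y n) z) \<longlonglongrightarrow> E (u * v) z"
          by (intro E_lim tendsto_mult_left Y z)
        show "(\<lambda>n. E (u * Y n) z) \<longlonglongrightarrow> E u (\<phi>' v * z) + E v (\<phi>' u * z)"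
          unfolding half[OF Y(1)]
          by (intro tendsto_add E_lim E_lim2 \<phi>'_lim Y ideal z)
      qed
    qed
    \<comment> \<open>Multiplying by \<open>y\<close> moves any \<open>x\<close> of \<open>A\<close>
      into \<open>B\<close>, so \<open>d a\<close> is a functional on all of
      \<open>A\<close>.\<close>
    define d where "d a x = E a (x * y)" for a x
    obtain Cb where Cb: "0 \<le> Cb" "\<And>a. N (a * b) \<le> Cb * norm a"
      using segal_mult_bounded[OF seg \<open>b \<in> B\<close>] by blast
    obtain Cy where Cy: "0 \<le> Cy" "\<And>a. N (a * y) \<le> Cy * norm a"
      using segal_mult_bounded[OF seg \<open>y \<in> B\<close>] by blast
    \<comment> \<open>One summand for each term of \<open>E\<close>. Absolute values are taken
      because \<open>K\<close> and \<open>L\<close> carry no sign.\<close>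
    define Q where "Q = \<bar>K\<bar> * Cb * Cy + \<bar>K\<bar> * N b * Cy * \<bar>L\<bar>"
    have bound: "norm (d a x) \<le> Q * norm a * norm x" for a x
    proof -
      have Kabs: "norm (D u z) \<le> \<bar>K\<bar> * (N u * N z)" if "u \<in> B" "z \<in> B" for u z
      proof -
        have "K * (N u * N z) \<le> \<bar>K\<bar> * (N u * N z)"
          using BB.N_nonneg that by (intro mult_right_mono) auto
        then show ?thesis using Kb[OF that] by (simp add: mult.assoc)
      qed
      have "norm (D (a * b) (x * y)) \<le> \<bar>K\<bar> * (N (a * b) * N (x * y))"
        using that by (intro Kabs ideal)
      also have "\<dots> \<le> \<bar>K\<bar> * ((Cb * norm a) * (Cy * norm x))"
        using that Cb Cy by (intro mult_left_mono mult_mono BB.N_nonneg ideal) auto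
      finally have 1: "norm (D (a * b) (x * y)) \<le> \<bar>K\<bar> * ((Cb * norm a) * (Cy * norm x))" .
      have "norm (\<phi>' a) \<le> \<bar>L\<bar> * norm a"
        using L[of a] mult_right_mono[OF abs_ge_self[of L] norm_ge_zero[of a]] by linarith
      then have n: "norm (\<phi>' a * x) \<le> (\<bar>L\<bar> * norm a) * norm x"
        using norm_mult_ineq[of "\<phi>' a" x] by (meson mult_right_mono norm_ge_zero order_trans)
      have "norm (D b (\<phi>' a * (x * y))) \<le> \<bar>K\<bar> * (N b * N ((\<phi>' a * x) * y))"
        \<comment> \<open>Regrouping as \<open>(\<phi>' a * x) * y\<close> lets the constant
          \<open>Cy\<close> apply to the whole left factor.\<close>
        using that unfolding mult.assoc[of "\<phi>' a"] by (intro Kabs ideal)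
      also have "\<dots> \<le> \<bar>K\<bar> * (N b * (Cy * ((\<bar>L\<bar> * norm a) * norm x)))"
        using that Cy(2)[of "\<phi>' a * x"] mult_left_mono[OF n Cy(1)] BB.N_nonneg
        by (intro mult_left_mono) auto
      finally have 2: "norm (D b (\<phi>' a * (x * y))) \<le> \<bar>K\<bar> * (N b * (Cy * ((\<bar>L\<bar> * norm a) * norm x)))" .
      show ?thesis
        using norm_triangle_ineq4[of "D (a * b) (x * y)" "D b (\<phi>' a * (x * y))"] 1 2
        unfolding d_def E_def Q_def by (simp add: algebra_simps)
    qed
    have "bounded_derivation sc UNIV norm \<phi>' \<phi>' d"
      unfolding bounded_derivation_def
    proof (intro conjI ballI allI)
      show "d ` UNIV \<subseteq> dual sc UNIV norm"
      proof (clarsimp simp: dual_def linear_on_def, intro conjI allI exI)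
        show "norm (d a x) \<le> (Q * norm a) * norm x" for a x by (rule bound)
      qed (use that in \<open>simp_all add: d_def E_def ideal D_add2 D_scale2 distrib_left distrib_right
          A.scale_mult_left A.scale_mult_right right_diff_distrib\<close>)
      show "\<exists>Q. \<forall>a\<in>UNIV. dual_norm UNIV norm (d a) \<le> Q * norm a"
      proof (intro exI ballI)
        fix a :: 'a
        have Qa: "0 \<le> Q * norm a"
          using Cb Cy BB.N_nonneg that by (auto simp: Q_def intro!: mult_nonneg_nonneg add_nonneg_nonneg)
        show "dual_norm UNIV norm (d a) \<le> Q * norm a"
          unfolding dual_norm_def
        proof (rule cSUP_least)
          show "{x::'a \<in> UNIV. norm x \<le> 1} \<noteq> {}" by (auto intro: exI[of _ 0])
          show "norm (d a x) \<le> Q * norm a" if "x \<in> {x \<in> UNIV. norm x \<le> 1}" for x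
            using bound[of a x] mult_left_mono[of "norm x" 1, OF _ Qa] that by simp
        qed
      qed
      show "d (u * v) x = dual_ract \<phi>' (d u) v x + dual_lact \<phi>' u (d v) x" for u v x
        using E_mult[of "x * y" u v] that ideal
        by (simp add: d_def dual_ract_def dual_lact_def lact_def ract_def mult.assoc
            left_commute[of x "\<phi>' u" y])
    qed (use that in \<open>simp_all add: d_def E_def ideal D_add1 D_add2 D_scale1 D_scale2 add' scale'
          distrib_left distrib_right A.scale_mult_left right_diff_distrib\<close>)
    then have "inner_derivation sc UNIV norm \<phi>' \<phi>' d"
      using assms(8) by (auto simp: weakly_amenable_def)
    \<comment> \<open>The inner derivation has values
      \<open>\<xi> (\<phi>' a * x) - \<xi> (x * \<phi>' a)\<close>, which vanish by
      commutativity.\<close>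
    then have "d a x = 0"
      by (auto simp: inner_derivation_def dual_ract_def dual_lact_def lact_def ract_def
          commutative[of "\<phi>' _"])
    then show ?thesis using E_B that ideal by (simp add: d_def)
  qed

  \<comment> \<open>Removal of the auxiliary factors by the approximate identity\<close>
  have D_phi: "D a (\<phi>' b * y) = 0" if "a \<in> B" "b \<in> B" "y \<in> B" for a b y
  proof -
    have "((\<lambda>i. D a (e i * (\<phi>' b * y))) \<longlongrightarrow> D a (\<phi>' b * y)) F"
      using that by (intro lim2 e_lim ideal)
    \<comment> \<open>This is \<open>key\<close> with \<open>x = e i\<close>, after moving
      \<open>e i\<close> past \<open>\<phi>' b\<close>.\<close>
    moreover have "D a (e i * (\<phi>' b * y)) = 0" for i
      using key[OF that, of "e i"] by (metis commutative mult.assoc)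
    ultimately show ?thesis using F by (simp add: tendsto_const_iff)
  qed
  have "D a x = 0" if "a \<in> B" "x \<in> B" for a x
  proof -
    have "((\<lambda>i. D (e i * a) x) \<longlongrightarrow> D a x) F"
      using that by (intro lim1 e_lim ideal)
    \<comment> \<open>The product rule gives
      \<open>D (e i) (\<phi>' a * x) + D a (\<phi>' (e i) * x)\<close>, and \<open>D_phi\<close>
      kills both terms.\<close>
    moreover have "D (e i * a) x = 0" for i
      using D_mult[OF eB that, of i] D_phi that eB by simp
    ultimately show ?thesis using F by (simp add: tendsto_const_iff)
  qed
  then show "inner_derivation sc B N \<phi> \<phi> D"
    unfolding inner_derivation_def
    by (intro bexI[of _ "\<lambda>_. 0"])
      (auto simp: dual_ract_def dual_lact_def dual_def linear_on_def intro!: exI[of _ 0])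
qed

end
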